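(* Consider the two optimization problems over $\mathbf w\in\mathbb R^L$ $$\text{(P1)}\quad \min_{\mathbf w} P(\mathbf w)\ \text{ subject to } J(\mathbf w)\ge\check J,\qquad\qquad \text{(P2)}\quad \max_{\mathbf w} J(\mathbf w)\ \text{ subject to } P(\mathbf w)\le\hat P,$$ where $\check J>0$ is a given information threshold and $\hat P>0$ is a given energy budget, and where the optimal solutions of (P1) and (P2) are denoted by $\mathbf w_1$ and $\mathbf w_2$, respectively. If $\check J=J(\mathbf w_2)$, then $\mathbf w_1=\mathbf w_2$. If $\hat P=P(\mathbf w_1)$, then $\mathbf w_2=\mathbf w_1$.
   Context: Let $N\ge1$, $L=N^2$. Given: $\eta^2>0$, $\xi^2>0$, vectors $\mathbf h,\mathbf g\in\mathbb R^N$, and symmetric positive definite $N\times N$ matrices $\boldsymbol\Sigma_h,\boldsymbol\Sigma_g,\boldsymbol\Sigma_\epsilon$. Set $\boldsymbol\Sigma_x=\boldsymbol\Sigma_\epsilon+\eta^2(\mathbf h\mathbf h^T+\boldsymbol\Sigma_h)$. For $l\in\{1,\dots,L\}$ let $m_l=\lceil l/N\rceil$ and $n_l=l-(m_l-1)N$. Let $\mathbf G\in\mathbb R^{L\times N}$ have entries $[\mathbf G]_{l,n}=g_{m_l}$ if $n=n_l$ and $0$ otherwise, and let $\mathbf H=\mathbf I_N\otimes\mathbf h\in\mathbb R^{L\times N}$ ($\otimes$ = Kronecker product). Define the symmetric positive semidefinite $L\times L$ matrices $$\boldsymbol\Omega_T=\mathbf I_N\otimes\boldsymbol\Sigma_x,\quad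 \boldsymbol\Omega_{JN}=\mathbf G\mathbf h\mathbf h^T\mathbf G^T,$$ $$\boldsymbol\Omega_{JD}=\mathbf G(\boldsymbol\Sigma_\epsilon+\eta^2\boldsymbol\Sigma_h)\mathbf G^T+\eta^2\mathbf H\boldsymbol\Sigma_g\mathbf H^T+\eta^2\,\boldsymbol\Sigma_g\otimes\boldsymbol\Sigma_h+\boldsymbol\Sigma_g\otimes\boldsymbol\Sigma_\epsilon .$$ Let $c_1,\dots,c_L\ge0$ be given collaboration costs, $c_l=C_{m_ln_l}$ for a cost matrix $\mathbf C\in\mathbb R^{N\times N}$ with zero diagonal. For a scalar $x$, $\mathrm{card}(x)=0$ if $x=0$ and $1$ otherwise. The functions are $$J(\mathbf w)=\frac{\mathbf w^T\boldsymbol\Omega_{JN}\mathbf w}{\mathbf w^T\boldsymbol\Omega_{JD}\mathbf w+\xi^2},\qquad P(\mathbf w)=\mathbf w^T\boldsymbol\Omega_T\mathbf w+\sum_{l=1}^L c_l\,\mathrm{card}(w_l).$$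
   Formalization: Since J and P are even, optimal solutions are never unique (w and −w are both optimal), so w₁ = w₂ fails for arbitrary choices; the equality is stated instead as equality of the full sets of optimal solutions of (P1) and (P2), whenever an optimal w₂ (resp. w₁) as in the hypothesis exists. *)

theory Defs
  imports Complex_Main "Jordan_Normal_Form.Matrix"
begin

definition pos_def_mat :: "nat \<Rightarrow> real mat \<Rightarrow> bool" where
  "pos_def_mat n A \<longleftrightarrow> A \<in> carrier_mat n n \<and> A\<^sup>T = A \<and>
     (\<forall>v \<in> carrier_vec n. v \<noteq> 0\<^sub>v n \<longrightarrow> v \<bullet> (A *\<^sub>v v) > 0)"

definition kronecker :: "real mat \<Rightarrow> real mat \<Rightarrow> real mat" (infixl \<open>\<otimes>\<^sub>K\<close> 70) where
  "A \<otimes>\<^sub>K B = mat (dim_row A * dim_row B) (dim_col A * dim_col B)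
     (\<lambda>(i, j). A $$ (i div dim_row B, j div dim_col B) * B $$ (i mod dim_row B, j mod dim_col B))"

definition col_mat :: "real vec \<Rightarrow> real mat" where
  "col_mat v = mat_of_cols (dim_vec v) [v]"

text \<open>The indices \<open>l\<close>, \<open>m_l\<close> and \<open>n_l\<close> are 1-based, with \<open>l\<close> ranging over
  \<open>{1..N\<^sup>2}\<close>. Vector and matrix entries are 0-based, hence the shifts by one below.\<close>

definition m_idx :: "nat \<Rightarrow> nat \<Rightarrow> nat" where
  "m_idx N l = nat \<lceil>real l / real N\<rceil>"

definition n_idx :: "nat \<Rightarrow> nat \<Rightarrow> nat" where
  "n_idx N l = l - (m_idx N l - 1) * N"

definition G_mat :: "nat \<Rightarrow> real vec \<Rightarrow> real mat" where
  "G_mat N g = mat (N\<^sup>2) N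
     (\<lambda>(i, j). if j + 1 = n_idx N (i + 1) then g $ (m_idx N (i + 1) - 1) else 0)"

definition H_mat :: "nat \<Rightarrow> real vec \<Rightarrow> real mat" where
  "H_mat N h = 1\<^sub>m N \<otimes>\<^sub>K col_mat h"

definition collab_cost :: "nat \<Rightarrow> real mat \<Rightarrow> nat \<Rightarrow> real" where
  "collab_cost N C l = C $$ (m_idx N l - 1, n_idx N l - 1)"

text \<open>The parameters \<open>\<eta>2\<close> and \<open>\<xi>2\<close> stand for the positive numbers \<open>\<eta>\<^sup>2\<close> and \<open>\<xi>\<^sup>2\<close>.\<close>

definition Sigma_x :: "real \<Rightarrow> real vec \<Rightarrow> real mat \<Rightarrow> real mat \<Rightarrow> real mat" where
  "Sigma_x \<eta>2 h \<Sigma>h \<Sigma>\<epsilon> = \<Sigma>\<epsilon> + \<eta>2 \<cdot>\<^sub>m (col_mat h * (col_mat h)\<^sup>T + \<Sigma>h)"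

definition Omega_T :: "nat \<Rightarrow> real \<Rightarrow> real vec \<Rightarrow> real mat \<Rightarrow> real mat \<Rightarrow> real mat" where
  "Omega_T N \<eta>2 h \<Sigma>h \<Sigma>\<epsilon> = 1\<^sub>m N \<otimes>\<^sub>K Sigma_x \<eta>2 h \<Sigma>h \<Sigma>\<epsilon>"

definition Omega_JN :: "nat \<Rightarrow> real vec \<Rightarrow> real vec \<Rightarrow> real mat" where
  "Omega_JN N h g = G_mat N g * col_mat h * (col_mat h)\<^sup>T * (G_mat N g)\<^sup>T"

definition Omega_JD ::
  "nat \<Rightarrow> real \<Rightarrow> real vec \<Rightarrow> real vec \<Rightarrow> real mat \<Rightarrow> real mat \<Rightarrow> real mat \<Rightarrow> real mat" where
  "Omega_JD N \<eta>2 h g \<Sigma>h \<Sigma>g \<Sigma>\<epsilon> =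
     G_mat N g * (\<Sigma>\<epsilon> + \<eta>2 \<cdot>\<^sub>m \<Sigma>h) * (G_mat N g)\<^sup>T
     + \<eta>2 \<cdot>\<^sub>m (H_mat N h * \<Sigma>g * (H_mat N h)\<^sup>T)
     + \<eta>2 \<cdot>\<^sub>m (\<Sigma>g \<otimes>\<^sub>K \<Sigma>h)
     + \<Sigma>g \<otimes>\<^sub>K \<Sigma>\<epsilon>"

definition information ::
  "nat \<Rightarrow> real \<Rightarrow> real \<Rightarrow> real vec \<Rightarrow> real vec \<Rightarrow> real mat \<Rightarrow> real mat \<Rightarrow> real mat \<Rightarrow> real vec \<Rightarrow> real"
  where
  "information N \<eta>2 \<xi>2 h g \<Sigma>h \<Sigma>g \<Sigma>\<epsilon> w =
     (w \<bullet> (Omega_JN N h g *\<^sub>v w)) / (w \<bullet> (Omega_JD N \<eta>2 h g \<Sigma>h \<Sigma>g \<Sigma>\<epsilon> *\<^sub>v w) + \<xi>2)"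

definition card_scalar :: "real \<Rightarrow> real" where
  "card_scalar x = (if x = 0 then 0 else 1)"

definition energy ::
  "nat \<Rightarrow> real \<Rightarrow> real vec \<Rightarrow> real mat \<Rightarrow> real mat \<Rightarrow> real mat \<Rightarrow> real vec \<Rightarrow> real" where
  "energy N \<eta>2 h \<Sigma>h \<Sigma>\<epsilon> C w =
     w \<bullet> (Omega_T N \<eta>2 h \<Sigma>h \<Sigma>\<epsilon> *\<^sub>v w)
     + (\<Sum>l = 1..N\<^sup>2. collab_cost N C l * card_scalar (w $ (l - 1)))"

definition P1_solutions ::
  "nat \<Rightarrow> (real vec \<Rightarrow> real) \<Rightarrow> (real vec \<Rightarrow> real) \<Rightarrow> real \<Rightarrow> real vec set" where
  "P1_solutions L J P Jc = {w. is_arg_min P (\<lambda>w. w \<in> carrier_vec L \<and> J w \<ge> Jc) w}"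

definition P2_solutions ::
  "nat \<Rightarrow> (real vec \<Rightarrow> real) \<Rightarrow> (real vec \<Rightarrow> real) \<Rightarrow> real \<Rightarrow> real vec set" where
  "P2_solutions L J P Pc = {w. is_arg_max J (\<lambda>w. w \<in> carrier_vec L \<and> P w \<le> Pc) w}"

text \<open>\<open>information\<close> and \<open>energy\<close> are even functions of \<open>w\<close>, so with every optimal
  \<open>w\<close> also \<open>-w\<close> is optimal, and a nonzero solution is never unique. That the optimal
  solutions of the two problems agree therefore means equality of these solution sets.\<close>

end

theory Submission
  imports Defs
begin

text \<open>Scaling \<open>w\<close> by \<open>t \<noteq> 0\<close> multiplies all three quadratic forms by \<open>t\<^sup>2\<close> and leaves the
  cardinality term unchanged. Hence along a ray with \<open>J w > 0\<close> both \<open>J\<close> and \<open>P\<close> are continuous and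
  strictly increasing: slack in the energy budget can be spent on more information, and
  slack in the information threshold can be turned into less energy. So both constraints are active
  at every optimum, and either solution set is \<open>{w. P w \<le> Pc \<and> J w \<ge> Jc}\<close>.
  Strict monotonicity needs \<open>\<Omega>_T\<close> positive definite and \<open>\<Omega>_JD\<close> positive semidefinite; for
  \<open>\<Sigma>g \<otimes>\<^sub>K \<Sigma>h\<close> the latter is the Schur product theorem.\<close>

section \<open>Exchange of minimisation and maximisation\<close>

text \<open>The disjunction lets one lemma serve both halves of the theorem: \<open>v\<close> solves
  one problem, and the bound of the other problem is the value of \<open>v\<close>. In either case
  \<open>v\<close> meets both bounds and neither bound can be beaten while the other is kept, so
  \<open>Pc\<close> is the minimum and \<open>Jc\<close> the maximum.\<close>

lemma argmin_argmax_exchange: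
  fixes J P :: "'a::zero vec \<Rightarrow> real"
  assumes "Jc > 0"
    and up: "\<And>w p. w \<in> carrier_vec L \<Longrightarrow> J w > 0 \<Longrightarrow> P w < p \<Longrightarrow>
               \<exists>w' \<in> carrier_vec L. J w < J w' \<and> P w' \<le> p"
    and down: "\<And>w j. w \<in> carrier_vec L \<Longrightarrow> 0 < j \<Longrightarrow> j < J w \<Longrightarrow>
               \<exists>w' \<in> carrier_vec L. j \<le> J w' \<and> P w' < P w"
    and "(is_arg_max J (\<lambda>w. w \<in> carrier_vec L \<and> P w \<le> Pc) v \<and> Jc = J v) \<or>
         (is_arg_min P (\<lambda>w. w \<in> carrier_vec L \<and> J w \<ge> Jc) v \<and> Pc = P v)"
  shows "is_arg_min P (\<lambda>w. w \<in> carrier_vec L \<and> J w \<ge> Jc) u \<longleftrightarrow>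
         is_arg_max J (\<lambda>w. w \<in> carrier_vec L \<and> P w \<le> Pc) u"
proof -
  have v: "v \<in> carrier_vec L" "J v \<ge> Jc" "P v \<le> Pc"
    using assms(4) by (auto simp: is_arg_max_def is_arg_min_def)
  have P_ge: "P w \<ge> Pc" if w: "w \<in> carrier_vec L" "J w \<ge> Jc" for w
    using assms(4)
  proof
    assume *: "is_arg_max J (\<lambda>w. w \<in> carrier_vec L \<and> P w \<le> Pc) v \<and> Jc = J v"
    show ?thesis
    proof (rule ccontr)
      assume "\<not> ?thesis"
      \<comment> \<open>\<open>up\<close> spends the energy left below \<open>Pc\<close> and would
        yield more information than \<open>v\<close> within the budget.\<close>
      then obtain w' where "w' \<in> carrier_vec L" "J w < J w'" "P w' \<le> Pc"
        using up[of w Pc] w \<open>Jc > 0\<close> by auto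
      with * w show False by (auto simp: is_arg_max_def)
    qed
  qed (use w in \<open>auto simp: is_arg_min_def not_less\<close>)
  have J_le: "J w \<le> Jc" if w: "w \<in> carrier_vec L" "P w \<le> Pc" for w
  proof (rule ccontr)
    assume "\<not> ?thesis"
    \<comment> \<open>\<open>down\<close> trades the surplus over \<open>Jc\<close> for an energy
      strictly below \<open>Pc\<close>, which \<open>P_ge\<close> excludes.\<close>
    then obtain w' where w': "w' \<in> carrier_vec L" "Jc \<le> J w'" "P w' < P w"
      using down[of w Jc] w \<open>Jc > 0\<close> by auto
    with P_ge[of w'] w show False by simp
  qed
  show ?thesis
    unfolding is_arg_max_def is_arg_min_def using v P_ge J_le
    by (metis order.antisym linorder_not_less order.trans)
qed

section \<open>Quadratic forms and semidefinite matrices\<close>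

lemma scalar_prod_mult_mat_vec_sum:
  assumes "A \<in> carrier_mat n n" "v \<in> carrier_vec n"
  shows "v \<bullet> (A *\<^sub>v v) = (\<Sum>i<n. \<Sum>j<n. v $ i * A $$ (i, j) * v $ j)"
  using assms
  by (auto simp: scalar_prod_def sum_distrib_left mult.assoc atLeast0LessThan intro!: sum.cong)

lemma scalar_prod_mult_mat_vec_smult:
  fixes A :: "real mat"
  assumes "A \<in> carrier_mat n n" "w \<in> carrier_vec n"
  shows "(t \<cdot>\<^sub>v w) \<bullet> (A *\<^sub>v (t \<cdot>\<^sub>v w)) = t\<^sup>2 * (w \<bullet> (A *\<^sub>v w))"
  using assms by (simp add: mult_mat_vec[OF assms] power2_eq_square mult.assoc)

text \<open>Only the sign of the form is recorded, not symmetry, so that closure under sums,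
  congruences and Kronecker products is a statement about forms alone.\<close>

definition pos_semidef_mat :: "nat \<Rightarrow> real mat \<Rightarrow> bool" where
  "pos_semidef_mat n A \<longleftrightarrow> A \<in> carrier_mat n n \<and> (\<forall>v \<in> carrier_vec n. 0 \<le> v \<bullet> (A *\<^sub>v v))"

lemma pos_def_imp_semidef: "pos_def_mat n A \<Longrightarrow> pos_semidef_mat n A"
  unfolding pos_def_mat_def pos_semidef_mat_def
  by (metis mult_mat_vec_carrier order.refl order_less_imp_le scalar_prod_left_zero)

lemma pos_semidef_mat_add:
  "pos_semidef_mat n A \<Longrightarrow> pos_semidef_mat n B \<Longrightarrow> pos_semidef_mat n (A + B)"
  unfolding pos_semidef_mat_def
  by (auto simp: add_mult_distrib_mat_vec[of _ n n] scalar_prod_add_distrib[of _ n])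

lemma pos_semidef_mat_smult:
  assumes "pos_semidef_mat n A" "0 \<le> c"
  shows "pos_semidef_mat n (c \<cdot>\<^sub>m A)"
proof -
  have "v \<bullet> ((c \<cdot>\<^sub>m A) *\<^sub>v v) = c * (v \<bullet> (A *\<^sub>v v))" if "v \<in> carrier_vec n" for v
    using assms that unfolding pos_semidef_mat_def
    by (auto simp: scalar_prod_mult_mat_vec_sum[of _ n] sum_distrib_left intro!: sum.cong)
  with assms show ?thesis by (simp add: pos_semidef_mat_def)
qed

text \<open>The form of the product at \<open>v\<close> is the form of \<open>A\<close> at
  \<open>B\<^sup>T *\<^sub>v v\<close>.\<close>

lemma pos_semidef_mat_congruence:
  assumes "pos_semidef_mat n A" and B: "B \<in> carrier_mat m n"
  shows "pos_semidef_mat m (B * A * B\<^sup>T)"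
  unfolding pos_semidef_mat_def
proof (intro conjI ballI)
  have A: "A \<in> carrier_mat n n" using assms by (simp add: pos_semidef_mat_def)
  show "B * A * B\<^sup>T \<in> carrier_mat m m" using A B by auto
  fix v :: "real vec" assume v: "v \<in> carrier_vec m"
  define u where "u = B\<^sup>T *\<^sub>v v"
  have u: "u \<in> carrier_vec n" using B v by (auto simp: u_def)
  have "v \<bullet> (B * A * B\<^sup>T *\<^sub>v v) = v \<bullet> (B *\<^sub>v (A *\<^sub>v u))"
    using A B v by (simp add: u_def assoc_mult_mat_vec[of _ m n _ m] assoc_mult_mat_vec[of _ m n _ n])
  also have "\<dots> = u \<bullet> (A *\<^sub>v u)"
    unfolding u_def[symmetric] using A B v u
    by (simp add: u_def transpose_vec_mult_scalar[of _ m n])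
  finally show "0 \<le> v \<bullet> (B * A * B\<^sup>T *\<^sub>v v)"
    using assms(1) u by (simp add: pos_semidef_mat_def)
qed

lemma pos_semidef_mat_one: "pos_semidef_mat n (1\<^sub>m n)"
  by (auto simp: pos_semidef_mat_def scalar_prod_def intro!: sum_nonneg)

text \<open>The conclusion is positivity of the form, the shape in which
  \<open>one_kronecker_pos\<close> takes its hypothesis on the block.\<close>

lemma pos_def_mat_add_semidef:
  assumes "pos_def_mat n A" "pos_semidef_mat n B" "v \<in> carrier_vec n" "v \<noteq> 0\<^sub>v n"
  shows "0 < v \<bullet> ((A + B) *\<^sub>v v)"
  using assms unfolding pos_def_mat_def pos_semidef_mat_def
  by (auto simp: add_mult_distrib_mat_vec[of _ n n] scalar_prod_add_distrib[of _ n] add_pos_nonneg)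

section \<open>Schur product theorem\<close>

lemma schur_product_nonneg:
  fixes A B :: "'i \<Rightarrow> 'i \<Rightarrow> real"
  assumes "finite S"
    and "\<And>i j. i \<in> S \<Longrightarrow> j \<in> S \<Longrightarrow> A i j = A j i"
    and "\<And>x i. i \<in> S \<Longrightarrow> x i \<noteq> 0 \<Longrightarrow> 0 < (\<Sum>i\<in>S. \<Sum>j\<in>S. x i * A i j * x j)"
    and "\<And>x. 0 \<le> (\<Sum>i\<in>S. \<Sum>j\<in>S. x i * B i j * x j)"
  shows "0 \<le> (\<Sum>i\<in>S. \<Sum>j\<in>S. A i j * B i j)"
  using assms
proof (induction S arbitrary: A rule: finite_induct)
  case (insert s T)
  note sym = insert.prems(1) and pd = insert.prems(2) and psd = insert.prems(3)
  define a where "a = A s s"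
  \<comment> \<open>The unit vector at \<open>s\<close> shows that the pivot \<open>a\<close> is
    positive.\<close>
  have "0 < (\<Sum>i\<in>insert s T. \<Sum>j\<in>insert s T. of_bool (i = s) * A i j * of_bool (j = s))"
    by (rule pd[of s]) auto
  also have "\<dots> = a"
  proof -
    have "(\<Sum>j\<in>insert s T. of_bool (i = s) * A i j * of_bool (j = s)) = (if i = s then a else 0)" for i
      using insert.hyps by (auto simp: a_def intro!: sum.neutral)
    then show ?thesis using insert.hyps by simp
  qed
  finally have a: "a > 0" .
  \<comment> \<open>Subtracting the rank-one matrix built from column \<open>s\<close> leaves the Schur complement,
    which vanishes in row and column \<open>s\<close> and is positive definite on \<open>T\<close>.\<close>
  define A' where "A' i j = A i j - A i s * A j s / a" for i j
  have A's: "A' s j = 0" "A' j s = 0" if "j \<in> insert s T" for j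
    using a sym[of s j] that by (auto simp: A'_def a_def)
  have restrict: "(\<Sum>i\<in>insert s T. \<Sum>j\<in>insert s T. A' i j * f i j) = (\<Sum>i\<in>T. \<Sum>j\<in>T. A' i j * f i j)"
    for f using insert.hyps A's by simp
  \<comment> \<open>The weight \<open>f\<close> is arbitrary because the splitting is used twice:
    with \<open>B\<close>, and with \<open>y i * y j\<close> to show that the complement is positive
    definite.\<close>
  have split: "(\<Sum>i\<in>insert s T. \<Sum>j\<in>insert s T. A i j * f i j) =
      (\<Sum>i\<in>insert s T. \<Sum>j\<in>insert s T. A i s * f i j * A j s) / a + (\<Sum>i\<in>T. \<Sum>j\<in>T. A' i j * f i j)" for f
    unfolding restrict[symmetric]
    unfolding A'_def sum_divide_distrib sum.distrib[symmetric]
    by (intro sum.cong refl) (simp add: algebra_simps)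
  have "0 \<le> (\<Sum>i\<in>T. \<Sum>j\<in>T. A' i j * B i j)"
  proof (rule insert.IH)
    show "A' i j = A' j i" if "i \<in> T" "j \<in> T" for i j
      using sym[of i j] that by (simp add: A'_def)
    show "0 \<le> (\<Sum>i\<in>T. \<Sum>j\<in>T. x i * B i j * x j)" for x
    proof -
      \<comment> \<open>Extending \<open>x\<close> by zero at \<open>s\<close> restricts the form of
        \<open>B\<close> to \<open>T\<close>.\<close>
      have "(\<Sum>i\<in>insert s T. \<Sum>j\<in>insert s T. (x(s := 0)) i * B i j * (x(s := 0)) j)
          = (\<Sum>i\<in>T. \<Sum>j\<in>T. x i * B i j * x j)"
        using insert.hyps by (auto intro!: sum.cong)
      with psd[of "x(s := 0)"] show ?thesis by simp
    qed
    show "0 < (\<Sum>i\<in>T. \<Sum>j\<in>T. x i * A' i j * x j)" if "i \<in> T" "x i \<noteq> 0" for x i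
    proof -
      \<comment> \<open>The value at \<open>s\<close> that minimises the form, i.e. makes column \<open>s\<close> orthogonal to \<open>y\<close>.\<close>
      define y where "y = x(s := - (\<Sum>j\<in>T. x j * A j s) / a)"
      have yT: "y j = x j" if "j \<in> T" for j using insert.hyps that by (auto simp: y_def)
      have "(\<Sum>j\<in>insert s T. y j * A j s) = y s * a + (\<Sum>j\<in>T. x j * A j s)"
        using insert.hyps yT by (simp add: a_def)
      also have "\<dots> = 0" using a by (simp add: y_def)
      finally have orth: "(\<Sum>j\<in>insert s T. y j * A j s) = 0" .
      have "0 < (\<Sum>i\<in>insert s T. \<Sum>j\<in>insert s T. y i * A i j * y j)"
        using that yT by (intro pd[of i]) auto
      also have "\<dots> = (\<Sum>i\<in>insert s T. \<Sum>j\<in>insert s T. A i j * (y i * y j))"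
        by (simp only: mult_ac)
      also have "\<dots> = (\<Sum>i\<in>insert s T. \<Sum>j\<in>insert s T. (y i * A i s) * (y j * A j s)) / a
          + (\<Sum>i\<in>T. \<Sum>j\<in>T. A' i j * (y i * y j))"
        unfolding split by (simp only: mult_ac)
      \<comment> \<open>The rank-one term is the square of the sum in \<open>orth\<close>, divided
        by \<open>a\<close>, hence zero.\<close>
      also have "\<dots> = (\<Sum>i\<in>T. \<Sum>j\<in>T. A' i j * (y i * y j))"
        unfolding sum_product[symmetric] orth by simp
      also have "\<dots> = (\<Sum>i\<in>T. \<Sum>j\<in>T. x i * A' i j * x j)"
        using yT by (intro sum.cong refl) simp
      finally show ?thesis .
    qed
  qed
  \<comment> \<open>The rank-one part is the form of \<open>B\<close> at column \<open>s\<close> of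
    \<open>A\<close>, divided by the pivot.\<close>
  moreover have "0 \<le> (\<Sum>i\<in>insert s T. \<Sum>j\<in>insert s T. A i s * B i j * A j s) / a"
    using psd[of "\<lambda>i. A i s"] a by simp
  ultimately show ?case unfolding split by simp
qed simp

section \<open>Kronecker products\<close>

lemma sum_lessThan_mult:
  fixes f :: "nat \<Rightarrow> 'a::comm_monoid_add"
  shows "sum f {..<n * m} = (\<Sum>i<n. \<Sum>r<m. f (i * m + r))"
proof -
  have "sum f {i * m..<i * m + m} = (\<Sum>r<m. f (i * m + r))" for i
    using sum.shift_bounds_nat_ivl[of f 0 "i * m" m]
    by (simp add: add.commute atLeast0LessThan)
  then show ?thesis by (simp flip: sum.nat_group)
qed

lemma kronecker_carrier:
  "A \<in> carrier_mat n k \<Longrightarrow> B \<in> carrier_mat m l \<Longrightarrow> A \<otimes>\<^sub>K B \<in> carrier_mat (n * m) (k * l)"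
  by (auto simp: kronecker_def)

lemma block_index_less:
  fixes i n r m :: nat
  shows "i < n \<Longrightarrow> r < m \<Longrightarrow> i * m + r < n * m"
  using mult_le_mono1[of "Suc i" n m] by simp

text \<open>The inner double sum is the bilinear form of \<open>B\<close> between blocks
  \<open>i\<close> and \<open>j\<close> of \<open>w\<close>. The outer sum then has the shape of
  \<open>schur_product_nonneg\<close>, and for \<open>A\<close> the identity only the diagonal
  blocks survive.\<close>

lemma kronecker_quadratic_form:
  assumes A: "A \<in> carrier_mat n n" and B: "B \<in> carrier_mat m m"
    and w: "w \<in> carrier_vec (n * m)"
  shows "w \<bullet> ((A \<otimes>\<^sub>K B) *\<^sub>v w) =
    (\<Sum>i<n. \<Sum>j<n. A $$ (i, j) * (\<Sum>r<m. \<Sum>q<m. w $ (i * m + r) * B $$ (r, q) * w $ (j * m + q)))"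
proof -
  have "w \<bullet> ((A \<otimes>\<^sub>K B) *\<^sub>v w) = (\<Sum>i<n. \<Sum>r<m. \<Sum>j<n. \<Sum>q<m.
      w $ (i * m + r) * (A \<otimes>\<^sub>K B) $$ (i * m + r, j * m + q) * w $ (j * m + q))"
    by (simp add: scalar_prod_mult_mat_vec_sum[OF kronecker_carrier[OF A B] w] sum_lessThan_mult)
  also have "\<dots> = (\<Sum>i<n. \<Sum>r<m. \<Sum>j<n. \<Sum>q<m.
      A $$ (i, j) * (w $ (i * m + r) * B $$ (r, q) * w $ (j * m + q)))"
    using A B by (intro sum.cong refl) (simp add: kronecker_def block_index_less)
  also have "\<dots> = (\<Sum>i<n. \<Sum>j<n. \<Sum>r<m. \<Sum>q<m.
      A $$ (i, j) * (w $ (i * m + r) * B $$ (r, q) * w $ (j * m + q)))"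
    by (intro sum.cong refl sum.swap)
  finally show ?thesis by (simp add: sum_distrib_left)
qed

text \<open>The block values \<open>K i j\<close> form a semidefinite matrix, so the Schur product
  theorem applies to \<open>A\<close> and \<open>K\<close>.\<close>

lemma pos_semidef_mat_kronecker:
  assumes A: "pos_def_mat n A" and B: "pos_semidef_mat m B"
  shows "pos_semidef_mat (n * m) (A \<otimes>\<^sub>K B)"
  unfolding pos_semidef_mat_def
proof (intro conjI ballI)
  have Ac: "A \<in> carrier_mat n n" and Bc: "B \<in> carrier_mat m m"
    using A B by (auto simp: pos_def_mat_def pos_semidef_mat_def)
  show "A \<otimes>\<^sub>K B \<in> carrier_mat (n * m) (n * m)" using Ac Bc by (rule kronecker_carrier)
  fix w :: "real vec" assume w: "w \<in> carrier_vec (n * m)"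
  define K where "K i j = (\<Sum>r<m. \<Sum>q<m. w $ (i * m + r) * B $$ (r, q) * w $ (j * m + q))" for i j
  have "0 \<le> (\<Sum>i<n. \<Sum>j<n. A $$ (i, j) * K i j)"
  proof (rule schur_product_nonneg)
    show "A $$ (i, j) = A $$ (j, i)" if "i \<in> {..<n}" "j \<in> {..<n}" for i j
      using A that Ac by (metis index_transpose_mat(1) carrier_matD lessThan_iff pos_def_mat_def)
    show "0 < (\<Sum>i<n. \<Sum>j<n. x i * A $$ (i, j) * x j)" if "i \<in> {..<n}" "x i \<noteq> 0" for x i
    proof -
      have "vec n x \<noteq> 0\<^sub>v n" using that by (metis index_vec index_zero_vec(1) lessThan_iff)
      then have "0 < vec n x \<bullet> (A *\<^sub>v vec n x)" using A by (simp add: pos_def_mat_def)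
      then show ?thesis by (simp add: scalar_prod_mult_mat_vec_sum[OF Ac])
    qed
    show "0 \<le> (\<Sum>i<n. \<Sum>j<n. x i * K i j * x j)" for x
    proof -
      \<comment> \<open>The blocks of \<open>w\<close> combined with coefficients \<open>x\<close>.
        Once the sums over \<open>r\<close> and \<open>q\<close> stand outside, those over
        \<open>i\<close> and \<open>j\<close> factor, and the form of \<open>K\<close> at
        \<open>x\<close> becomes the form of \<open>B\<close> at \<open>y\<close>.\<close>
      define y where "y = vec m (\<lambda>r. \<Sum>i<n. x i * w $ (i * m + r))"
      have "(\<Sum>i<n. \<Sum>j<n. x i * K i j * x j) = (\<Sum>i<n. \<Sum>j<n. \<Sum>r<m. \<Sum>q<m.
          B $$ (r, q) * ((x i * w $ (i * m + r)) * (x j * w $ (j * m + q))))"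
        by (simp add: K_def sum_distrib_left sum_distrib_right mult_ac)
      also have "\<dots> = (\<Sum>i<n. \<Sum>r<m. \<Sum>q<m. \<Sum>j<n.
          B $$ (r, q) * ((x i * w $ (i * m + r)) * (x j * w $ (j * m + q))))"
        by (subst sum.swap, subst (2) sum.swap) (rule refl)
      also have "\<dots> = (\<Sum>r<m. \<Sum>q<m. \<Sum>i<n. \<Sum>j<n.
          B $$ (r, q) * ((x i * w $ (i * m + r)) * (x j * w $ (j * m + q))))"
        by (subst sum.swap, subst (2) sum.swap) (rule refl)
      also have "\<dots> = (\<Sum>r<m. \<Sum>q<m. y $ r * B $$ (r, q) * y $ q)"
      proof (intro sum.cong refl)
        fix r q assume "r \<in> {..<m}" "q \<in> {..<m}"
        then have "(\<Sum>i<n. \<Sum>j<n. B $$ (r, q) * ((x i * w $ (i * m + r)) * (x j * w $ (j * m + q))))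
            = B $$ (r, q) * (y $ r * y $ q)"
          by (simp add: y_def sum_product flip: sum_distrib_left)
        then show "(\<Sum>i<n. \<Sum>j<n. B $$ (r, q) * ((x i * w $ (i * m + r)) * (x j * w $ (j * m + q))))
            = y $ r * B $$ (r, q) * y $ q" by (simp only: mult_ac)
      qed
      also have "\<dots> = y \<bullet> (B *\<^sub>v y)"
        by (rule scalar_prod_mult_mat_vec_sum[OF Bc, symmetric]) (simp add: y_def)
      also have "\<dots> \<ge> 0" using B by (simp add: pos_semidef_mat_def y_def)
      finally show ?thesis .
    qed
  qed simp
  then show "0 \<le> w \<bullet> ((A \<otimes>\<^sub>K B) *\<^sub>v w)"
    by (simp add: kronecker_quadratic_form[OF Ac Bc w] K_def)
qed

text \<open>The matrix is block diagonal, so its form is the sum of the forms of \<open>B\<close> at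
  the blocks of \<open>w\<close>. All are nonnegative, and the block containing a nonzero entry
  contributes strictly.\<close>

lemma one_kronecker_pos:
  assumes B: "B \<in> carrier_mat m m"
    and pos: "\<And>v. v \<in> carrier_vec m \<Longrightarrow> v \<noteq> 0\<^sub>v m \<Longrightarrow> 0 < v \<bullet> (B *\<^sub>v v)"
    and w: "w \<in> carrier_vec (n * m)" "w \<noteq> 0\<^sub>v (n * m)"
  shows "0 < w \<bullet> ((1\<^sub>m n \<otimes>\<^sub>K B) *\<^sub>v w)"
proof -
  define b where "b i = vec m (\<lambda>r. w $ (i * m + r))" for i
  define K where "K i j = (\<Sum>r<m. \<Sum>q<m. w $ (i * m + r) * B $$ (r, q) * w $ (j * m + q))" for i j
  have nonneg: "0 \<le> b i \<bullet> (B *\<^sub>v b i)" for i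
    using pos[of "b i"] B by (cases "b i = 0\<^sub>v m") (auto simp: b_def)
  obtain k where k: "k < n * m" "w $ k \<noteq> 0" using w by (metis eq_vecI carrier_vecD index_zero_vec)
  then have "m > 0" by (cases m) auto
  \<comment> \<open>Quotient and remainder of \<open>k\<close> by \<open>m\<close> give the block of
    the nonzero entry and its position there.\<close>
  then have km: "k div m < n" "k mod m < m" using k by (auto simp: less_mult_imp_div_less)
  then have "b (k div m) $ (k mod m) \<noteq> 0" using k by (simp add: b_def)
  then have "b (k div m) \<noteq> 0\<^sub>v m" using km by auto
  then have "0 < b (k div m) \<bullet> (B *\<^sub>v b (k div m))" by (intro pos) (simp_all add: b_def)
  then have "0 < (\<Sum>i<n. b i \<bullet> (B *\<^sub>v b i))"
    using km nonneg by (intro sum_pos2[of _ "k div m"]) auto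
  also have "(\<Sum>i<n. b i \<bullet> (B *\<^sub>v b i)) = (\<Sum>i<n. K i i)"
    by (intro sum.cong refl) (simp add: scalar_prod_mult_mat_vec_sum[OF B] b_def K_def)
  also have "\<dots> = (\<Sum>i<n. \<Sum>j<n. 1\<^sub>m n $$ (i, j) * K i j)"
  proof (intro sum.cong refl)
    fix i assume i: "i \<in> {..<n}"
    then have "(\<Sum>j<n. 1\<^sub>m n $$ (i, j) * K i j) = (\<Sum>j<n. if j = i then K i j else 0)"
      by (intro sum.cong) auto
    then show "K i i = (\<Sum>j<n. 1\<^sub>m n $$ (i, j) * K i j)" using i by simp
  qed
  finally show ?thesis by (simp add: kronecker_quadratic_form[OF _ B w(1)] K_def)
qed

section \<open>Definiteness of the model matrices\<close>

lemma Sigma_x_pos: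
  assumes "\<eta>2 > 0" and h: "h \<in> carrier_vec N"
    and "pos_def_mat N \<Sigma>h" "pos_def_mat N \<Sigma>\<epsilon>" "v \<in> carrier_vec N" "v \<noteq> 0\<^sub>v N"
  shows "0 < v \<bullet> (Sigma_x \<eta>2 h \<Sigma>h \<Sigma>\<epsilon> *\<^sub>v v)"
proof -
  have c: "col_mat h \<in> carrier_mat N 1" using h by (auto simp: col_mat_def)
  have "pos_semidef_mat N (col_mat h * (col_mat h)\<^sup>T)"
    \<comment> \<open>The rank-one matrix is the congruence of the one-by-one identity by the column
      \<open>h\<close>.\<close>
    using pos_semidef_mat_congruence[OF pos_semidef_mat_one c] by (simp only: right_mult_one_mat[OF c])
  then show ?thesis unfolding Sigma_x_def using assms
    by (auto intro!: pos_def_mat_add_semidef pos_semidef_mat_smult pos_semidef_mat_add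
        intro: pos_def_imp_semidef)
qed

lemma Sigma_x_carrier:
  assumes "h \<in> carrier_vec N" "pos_def_mat N \<Sigma>h" "pos_def_mat N \<Sigma>\<epsilon>"
  shows "Sigma_x \<eta>2 h \<Sigma>h \<Sigma>\<epsilon> \<in> carrier_mat N N"
  using assms by (auto simp: Sigma_x_def pos_def_mat_def col_mat_def)

lemma Omega_T_pos:
  assumes "\<eta>2 > 0" "h \<in> carrier_vec N" "pos_def_mat N \<Sigma>h" "pos_def_mat N \<Sigma>\<epsilon>"
    and "w \<in> carrier_vec (N\<^sup>2)" "w \<noteq> 0\<^sub>v (N\<^sup>2)"
  shows "0 < w \<bullet> (Omega_T N \<eta>2 h \<Sigma>h \<Sigma>\<epsilon> *\<^sub>v w)"
  unfolding Omega_T_def using assms Sigma_x_carrier[of h N \<Sigma>h \<Sigma>\<epsilon>]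
  by (intro one_kronecker_pos Sigma_x_pos) (auto simp: power2_eq_square)

lemma Omega_T_carrier:
  assumes "h \<in> carrier_vec N" "pos_def_mat N \<Sigma>h" "pos_def_mat N \<Sigma>\<epsilon>"
  shows "Omega_T N \<eta>2 h \<Sigma>h \<Sigma>\<epsilon> \<in> carrier_mat (N\<^sup>2) (N\<^sup>2)"
  unfolding Omega_T_def power2_eq_square
  by (intro kronecker_carrier Sigma_x_carrier assms) simp

lemma Omega_JN_carrier: "Omega_JN N h g \<in> carrier_mat (N\<^sup>2) (N\<^sup>2)"
  by (auto simp: Omega_JN_def G_mat_def)

text \<open>Two summands are congruences by \<open>G_mat N g\<close> and \<open>H_mat N h\<close>,
  the other two Kronecker products with the positive definite left factor
  \<open>\<Sigma>g\<close>.\<close>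

lemma Omega_JD_semidef:
  assumes "\<eta>2 > 0" "h \<in> carrier_vec N"
    and "pos_def_mat N \<Sigma>h" "pos_def_mat N \<Sigma>g" "pos_def_mat N \<Sigma>\<epsilon>"
  shows "pos_semidef_mat (N\<^sup>2) (Omega_JD N \<eta>2 h g \<Sigma>h \<Sigma>g \<Sigma>\<epsilon>)"
proof -
  have G: "G_mat N g \<in> carrier_mat (N\<^sup>2) N" by (simp add: G_mat_def)
  have "col_mat h \<in> carrier_mat N 1" using assms by (auto simp: col_mat_def)
  then have H: "H_mat N h \<in> carrier_mat (N\<^sup>2) N"
    using kronecker_carrier[of "1\<^sub>m N" N N "col_mat h" N 1] by (simp add: H_mat_def power2_eq_square)
  have "pos_semidef_mat (N\<^sup>2) (\<Sigma>g \<otimes>\<^sub>K \<Sigma>h)" "pos_semidef_mat (N\<^sup>2) (\<Sigma>g \<otimes>\<^sub>K \<Sigma>\<epsilon>)"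
    unfolding power2_eq_square using assms
    by (auto intro: pos_semidef_mat_kronecker pos_def_imp_semidef)
  then show ?thesis unfolding Omega_JD_def using assms G H
    by (auto intro!: pos_semidef_mat_add pos_semidef_mat_smult pos_semidef_mat_congruence[of N]
        intro: pos_def_imp_semidef)
qed

section \<open>Scaling along rays and the equality of the solution sets\<close>

text \<open>For \<open>t \<noteq> 0\<close> the support of \<open>w\<close> is kept, so the
  collaboration cost cancels in the increment.\<close>

lemma energy_smult:
  assumes "Omega_T N \<eta>2 h \<Sigma>h \<Sigma>\<epsilon> \<in> carrier_mat (N\<^sup>2) (N\<^sup>2)" "w \<in> carrier_vec (N\<^sup>2)" "t \<noteq> 0"
  shows "energy N \<eta>2 h \<Sigma>h \<Sigma>\<epsilon> C (t \<cdot>\<^sub>v w) =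
    energy N \<eta>2 h \<Sigma>h \<Sigma>\<epsilon> C w + (t\<^sup>2 - 1) * (w \<bullet> (Omega_T N \<eta>2 h \<Sigma>h \<Sigma>\<epsilon> *\<^sub>v w))"
proof -
  have "(\<Sum>l = 1..N\<^sup>2. collab_cost N C l * card_scalar ((t \<cdot>\<^sub>v w) $ (l - 1))) =
        (\<Sum>l = 1..N\<^sup>2. collab_cost N C l * card_scalar (w $ (l - 1)))"
    using assms by (intro sum.cong) (auto simp: card_scalar_def)
  then show ?thesis
    unfolding energy_def scalar_prod_mult_mat_vec_smult[OF assms(1,2)] by (simp add: algebra_simps)
qed

theorem proposition2:
  fixes N :: nat and \<eta>2 \<xi>2 Jc Pc :: real
    and h g :: "real vec" and \<Sigma>h \<Sigma>g \<Sigma>\<epsilon> C :: "real mat"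
    and J P :: "real vec \<Rightarrow> real"
  assumes "N \<ge> 1" and "\<eta>2 > 0" and "\<xi>2 > 0"
    and "h \<in> carrier_vec N" and "g \<in> carrier_vec N"
    and "pos_def_mat N \<Sigma>h" and "pos_def_mat N \<Sigma>g" and "pos_def_mat N \<Sigma>\<epsilon>"
    and "C \<in> carrier_mat N N" and "\<And>i. i < N \<Longrightarrow> C $$ (i, i) = 0"
    and "\<And>l. l \<in> {1..N\<^sup>2} \<Longrightarrow> collab_cost N C l \<ge> 0"
    and "J = information N \<eta>2 \<xi>2 h g \<Sigma>h \<Sigma>g \<Sigma>\<epsilon>"
    and "P = energy N \<eta>2 h \<Sigma>h \<Sigma>\<epsilon> C"
    and "Jc > 0" and "Pc > 0"
  shows "(\<forall>w2 \<in> P2_solutions (N\<^sup>2) J P Pc. Jc = J w2 \<longrightarrow>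
            P1_solutions (N\<^sup>2) J P Jc = P2_solutions (N\<^sup>2) J P Pc) \<and>
         (\<forall>w1 \<in> P1_solutions (N\<^sup>2) J P Jc. Pc = P w1 \<longrightarrow>
            P2_solutions (N\<^sup>2) J P Pc = P1_solutions (N\<^sup>2) J P Jc)"
proof -
  define a b q where "a w = w \<bullet> (Omega_JN N h g *\<^sub>v w)"
    and "b w = w \<bullet> (Omega_JD N \<eta>2 h g \<Sigma>h \<Sigma>g \<Sigma>\<epsilon> *\<^sub>v w)"
    and "q w = w \<bullet> (Omega_T N \<eta>2 h \<Sigma>h \<Sigma>\<epsilon> *\<^sub>v w)" for w
  have JD: "pos_semidef_mat (N\<^sup>2) (Omega_JD N \<eta>2 h g \<Sigma>h \<Sigma>g \<Sigma>\<epsilon>)"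
    by (intro Omega_JD_semidef assms)
  then have JDc: "Omega_JD N \<eta>2 h g \<Sigma>h \<Sigma>g \<Sigma>\<epsilon> \<in> carrier_mat (N\<^sup>2) (N\<^sup>2)"
    by (simp add: pos_semidef_mat_def)
  have Tc: "Omega_T N \<eta>2 h \<Sigma>h \<Sigma>\<epsilon> \<in> carrier_mat (N\<^sup>2) (N\<^sup>2)"
    by (intro Omega_T_carrier assms)
  have J: "J w = a w / (b w + \<xi>2)" for w
    by (simp add: assms(12) information_def a_def b_def)
  have J_smult: "J (t \<cdot>\<^sub>v w) = t\<^sup>2 * a w / (t\<^sup>2 * b w + \<xi>2)" if "w \<in> carrier_vec (N\<^sup>2)" for t w
    by (simp add: J a_def b_def that scalar_prod_mult_mat_vec_smult[OF Omega_JN_carrier]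
        scalar_prod_mult_mat_vec_smult[OF JDc])
  have P_smult: "P (t \<cdot>\<^sub>v w) = P w + (t\<^sup>2 - 1) * q w"
    if "w \<in> carrier_vec (N\<^sup>2)" "t \<noteq> 0" for t w
    using that energy_smult[OF Tc] by (simp add: assms(13) q_def)
  have b: "b w \<ge> 0" if "w \<in> carrier_vec (N\<^sup>2)" for w
    using JD that by (simp add: pos_semidef_mat_def b_def)
  have a: "a w > 0" if "w \<in> carrier_vec (N\<^sup>2)" "J w > 0" for w
    using that b[of w] \<open>\<xi>2 > 0\<close> by (simp add: J zero_less_divide_iff)
  have q: "q w > 0" if w: "w \<in> carrier_vec (N\<^sup>2)" "J w > 0" for w
  proof -
    have "a (0\<^sub>v (N\<^sup>2)) = 0"
      unfolding a_def by (rule scalar_prod_left_zero) (rule mult_mat_vec_carrier[OF Omega_JN_carrier], simp)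
    then have "w \<noteq> 0\<^sub>v (N\<^sup>2)" using a[OF w] by auto
    then show ?thesis unfolding q_def by (intro Omega_T_pos assms w)
  qed
  have up: "\<exists>w' \<in> carrier_vec (N\<^sup>2). J w < J w' \<and> P w' \<le> p"
    if w: "w \<in> carrier_vec (N\<^sup>2)" "J w > 0" and p: "P w < p" for w p
  proof -
    \<comment> \<open>The squared scale factor for which the increment \<open>(s - 1) * q w\<close>
      uses up the slack \<open>p - P w\<close> exactly.\<close>
    define s where "s = 1 + (p - P w) / q w"
    have s: "s > 1" using q[OF w] p by (simp add: s_def)
    \<comment> \<open>The cross-multiplied claim; the two sides differ by
      \<open>(s - 1) * a w * \<xi>2\<close>.\<close>
    have "a w * (s * b w + \<xi>2) < s * a w * (b w + \<xi>2)"
      using s a[OF w] \<open>\<xi>2 > 0\<close> by (simp add: algebra_simps)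
    moreover have "b w + \<xi>2 > 0" "s * b w + \<xi>2 > 0"
      using s b[OF w(1)] \<open>\<xi>2 > 0\<close> by (simp_all add: add_nonneg_pos)
    ultimately have "J w < J (sqrt s \<cdot>\<^sub>v w)"
      using s by (simp add: J_smult[OF w(1)] J[of w] divide_simps)
    moreover have "P (sqrt s \<cdot>\<^sub>v w) = p"
      using s q[OF w] by (simp add: P_smult[OF w(1)] s_def)
    ultimately show ?thesis using w by (intro bexI[of _ "sqrt s \<cdot>\<^sub>v w"]) auto
  qed
  have down: "\<exists>w' \<in> carrier_vec (N\<^sup>2). j \<le> J w' \<and> P w' < P w"
    if w: "w \<in> carrier_vec (N\<^sup>2)" and j: "0 < j" "j < J w" for w j
  proof -
    \<comment> \<open>The squared scale factor at which the information drops to exactly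
      \<open>j\<close>, that is the root of \<open>s * a w = j * (s * b w + \<xi>2)\<close>.\<close>
    define s where "s = j * \<xi>2 / (a w - j * b w)"
    have bx: "b w + \<xi>2 > 0" using b[OF w] \<open>\<xi>2 > 0\<close> by simp
    have jx: "0 < j * \<xi>2" using j \<open>\<xi>2 > 0\<close> by simp
    \<comment> \<open>This is \<open>j < J w\<close> multiplied out; it gives both a positive
      denominator in \<open>s\<close> and \<open>s < 1\<close>.\<close>
    have less: "j * \<xi>2 < a w - j * b w"
      using j bx by (simp add: J less_divide_eq algebra_simps)
    have s: "0 < s" "s < 1" using jx less by (simp_all add: s_def)
    have "s * (a w - j * b w) = j * \<xi>2" using jx less by (simp add: s_def)
    then have "s * a w = j * (s * b w + \<xi>2)" by (simp add: algebra_simps)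
    moreover have "s * b w + \<xi>2 > 0" using s b[OF w] \<open>\<xi>2 > 0\<close> by (simp add: add_nonneg_pos)
    ultimately have "J (sqrt s \<cdot>\<^sub>v w) = j" using s by (simp add: J_smult[OF w])
    moreover have "P (sqrt s \<cdot>\<^sub>v w) < P w"
      using s q[OF w] j by (simp add: P_smult[OF w] mult_neg_pos)
    ultimately show ?thesis using w by (intro bexI[of _ "sqrt s \<cdot>\<^sub>v w"]) auto
  qed
  \<comment> \<open>The remaining disjunctive premise is met by \<open>w2\<close> in the first half
    and by \<open>w1\<close> in the second, where the equivalence is read backwards.\<close>
  note exchange = argmin_argmax_exchange[where J = J and P = P, OF \<open>Jc > 0\<close> up down]
  show ?thesis
    unfolding P1_solutions_def P2_solutions_def mem_Collect_eq
    by (intro conjI ballI impI Collect_cong exchange exchange[symmetric]) auto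
qed

end
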